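(* Suppose that $D$ is a multipartite digraph that has no cyclic triangle. If $\beta(D)=1$ then $k(D)=1$, and if $\beta(D)=2$ then $k(D)\le 4$.
   Context: Digraphs are finite and loopless; $E(D)$ is the set of directed edges. A multipartite digraph is a digraph $D$ whose vertex set is partitioned into classes $A_1,\dots,A_t$ (the partite classes), each of which is an independent set. Two vertices are adjacent if there is an edge between them in at least one direction; an independent set is a set of pairwise nonadjacent vertices. A cyclic triangle consists of three vertices $u,v,w$ with $(u,v),(v,w),(w,u)\in E(D)$. For $S\subseteq\{1,\dots,t\}$, the set $U=\bigcup_{i\in S}A_i$ is called a dominating set of size $|S|$ if for every vertex $v\in\bigcup_{i\notin S}A_i$ there is a $w\in U$ with $(w,v)\in E(D)$. The smallest $|S|$ for which $D$ has a dominating set $\bigcup_{i\in S}A_i$ is denoted by $k(D)$. $\beta(D)$ denotes the cardinality of a largest independent set of $D$ whose vertices are from pairwise different partite classes. Not all edges between different partite classes need be present. *)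

theory Defs
  imports "Graph_Theory.Pair_Digraph"
begin

definition adjacent :: "'a pair_pre_digraph \<Rightarrow> 'a \<Rightarrow> 'a \<Rightarrow> bool" where
  "adjacent D u v \<longleftrightarrow> (u, v) \<in> parcs D \<or> (v, u) \<in> parcs D"

definition independent_set :: "'a pair_pre_digraph \<Rightarrow> 'a set \<Rightarrow> bool" where
  "independent_set D I \<longleftrightarrow>
     I \<subseteq> pverts D \<and> (\<forall>u\<in>I. \<forall>v\<in>I. u \<noteq> v \<longrightarrow> \<not> adjacent D u v)"

text \<open>
  A \<^locale>\<open>pair_digraph\<close> is finite and loopless; opposite arcs \<open>(u, v)\<close> and \<open>(v, u)\<close> may both be
  present. Only the values of \<open>A\<close> on \<open>{1..t}\<close> matter, and empty classes are permitted.
\<close>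

locale multipartite_digraph = pair_digraph D
  for D :: "'a pair_pre_digraph" and A :: "nat \<Rightarrow> 'a set" and t :: nat +
  assumes classes_cover: "(\<Union>i\<in>{1..t}. A i) = pverts D"
    and classes_disjoint: "disjoint_family_on A {1..t}"
    and classes_independent: "\<And>i. i \<in> {1..t} \<Longrightarrow> independent_set D (A i)"

text \<open>In a loopless digraph the three vertices of a cyclic triangle are automatically distinct.\<close>

definition has_cyclic_triangle :: "'a pair_pre_digraph \<Rightarrow> bool" where
  "has_cyclic_triangle D \<longleftrightarrow>
     (\<exists>u v w. (u, v) \<in> parcs D \<and> (v, w) \<in> parcs D \<and> (w, u) \<in> parcs D)"

definition dominating :: "'a pair_pre_digraph \<Rightarrow> (nat \<Rightarrow> 'a set) \<Rightarrow> nat \<Rightarrow> nat set \<Rightarrow> bool" where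
  "dominating D A t S \<longleftrightarrow> S \<subseteq> {1..t} \<and>
     (\<forall>v \<in> (\<Union>i\<in>{1..t} - S. A i). \<exists>w \<in> (\<Union>i\<in>S. A i). (w, v) \<in> parcs D)"

text \<open>The minimum exists, as \<open>{1..t}\<close> itself is dominating.\<close>

definition domination_number :: "'a pair_pre_digraph \<Rightarrow> (nat \<Rightarrow> 'a set) \<Rightarrow> nat \<Rightarrow> nat" where
  "domination_number D A t = (LEAST k. \<exists>S. dominating D A t S \<and> card S = k)"

definition from_different_classes :: "(nat \<Rightarrow> 'a set) \<Rightarrow> nat \<Rightarrow> 'a set \<Rightarrow> bool" where
  "from_different_classes A t I \<longleftrightarrow>
     (\<forall>u\<in>I. \<forall>v\<in>I. u \<noteq> v \<longrightarrow> \<not> (\<exists>i\<in>{1..t}. u \<in> A i \<and> v \<in> A i))"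

text \<open>For a finite digraph the maximum is over a finite set, nonempty because of \<open>I = {}\<close>.\<close>

definition multipartite_independence_number ::
    "'a pair_pre_digraph \<Rightarrow> (nat \<Rightarrow> 'a set) \<Rightarrow> nat \<Rightarrow> nat" where
  "multipartite_independence_number D A t =
     Max {card I | I. independent_set D I \<and> from_different_classes A t I}"

end

theory Submission
  imports Defs
begin

text \<open>
  Call two vertices \<^emph>\<open>apart\<close> if they are nonadjacent and lie in different classes, and say that a
  class \<^emph>\<open>spares\<close> a vertex outside it if it sends no arc to that vertex. A set \<open>S\<close> of classes is
  dominating exactly if no vertex is spared by all of \<open>S\<close>. The proof rests on one consequence of the
  absence of cyclic triangles: if \<open>y \<rightarrow> x\<close> then an in-neighbour \<open>a\<close> of \<open>y\<close> cannot be an out-neighbour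
  of \<open>x\<close>, so if moreover the class of \<open>a\<close> spares \<open>x\<close>, then \<open>a\<close> and \<open>x\<close> are apart.

  If no two vertices are apart, this says that \<open>y \<rightarrow> x\<close> makes \<open>y\<close> spared by all classes that spare
  \<open>x\<close>. Take a vertex \<open>x\<close> spared by the maximal number of classes. Were its own class not dominating,
  a vertex spared by that class would be spared by strictly more classes than \<open>x\<close>
  (lemma \<open>one_class_suffices\<close>).

  Suppose now that no three vertices are pairwise apart. Then the vertices apart from a given vertex
  contain no two apart vertices, so they are dominated by a single class. Moreover, if \<open>p\<close>
  and \<open>q\<close> are apart and \<open>y \<rightarrow> p\<close>, \<open>y \<rightarrow> q\<close>, then every class sparing both \<open>p\<close> and \<open>q\<close> spares \<open>y\<close>
  (lemma \<open>spared_by_in_neighbour_of_pair\<close>). Choose the apart pair \<open>p, q\<close> such that the set \<open>C\<close> of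
  classes sparing both is as large as possible. By maximality the vertices spared by \<open>C\<close> and by the
  classes of \<open>p\<close> and \<open>q\<close> contain no apart pair, so one class \<open>K\<close> dominates them. Let \<open>R\<close> be the set
  of vertices spared by \<open>K\<close> and by the classes of \<open>p\<close> and \<open>q\<close>. By the choice of \<open>K\<close>, no vertex of \<open>R\<close>
  is spared by all of \<open>C\<close>; so none sends arcs to both \<open>p\<close> and \<open>q\<close>, and each is apart from one of
  them. A chase through the possible arcs (lemma \<open>no_arc_between_sides\<close>) shows that a
  vertex of \<open>R\<close> apart from \<open>p\<close> is never adjacent to a vertex of \<open>R\<close> apart from \<open>q\<close>.

  If \<open>R\<close> has no apart pair, one further class dominates \<open>R\<close>, and together with \<open>K\<close> and the classes of
  \<open>p\<close> and \<open>q\<close> this makes four. Otherwise there are apart vertices \<open>u\<close>, \<open>u'\<close> in \<open>R\<close>, and one of them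
  is apart from \<open>p\<close>, the other from \<open>q\<close>. Use the classes of \<open>u\<close> and \<open>u'\<close> and two classes dominating
  the vertices apart from \<open>u\<close> and those apart from \<open>u'\<close>. A vertex \<open>y\<close> escaping all four would send
  arcs to both \<open>u\<close> and \<open>u'\<close>, so it would be spared by every class sparing both, and hence lie in
  \<open>R\<close>. But then \<open>y\<close> is apart from \<open>p\<close> or \<open>q\<close> and cannot be adjacent to both \<open>u\<close> and \<open>u'\<close>.
\<close>

section \<open>Spared vertices in multipartite digraphs without cyclic triangles\<close>

text \<open>
  Giving the partition as a map to class names, and using only names in \<open>c ` V\<close>, makes the classes
  disjoint and nonempty without further conditions.
\<close>

locale triangle_free_multipartite =
  fixes V :: "'a set" and E :: "('a \<times> 'a) set" and c :: "'a \<Rightarrow> 'c"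
  assumes finite_V: "finite V"
    and arc_between_classes: "(x, y) \<in> E \<Longrightarrow> c x \<noteq> c y"
    and no_triangle: "(x, y) \<in> E \<Longrightarrow> (y, z) \<in> E \<Longrightarrow> (z, x) \<notin> E"
begin

definition apart :: "'a \<Rightarrow> 'a \<Rightarrow> bool" where
  "apart x y \<longleftrightarrow> c x \<noteq> c y \<and> (x, y) \<notin> E \<and> (y, x) \<notin> E"

definition no_apart_pair :: "'a set \<Rightarrow> bool" where
  "no_apart_pair W \<longleftrightarrow> (\<forall>x\<in>W. \<forall>y\<in>W. \<not> apart x y)"

text \<open>
  The parameter \<open>W\<close> restricts the whole digraph to an induced subdigraph, so that domination by one
  class can be proved for every vertex set without apart pairs.
\<close>

definition sparing :: "'a set \<Rightarrow> 'a \<Rightarrow> 'c set" where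
  "sparing W x = {i \<in> c ` W. i \<noteq> c x \<and> (\<forall>a\<in>W. c a = i \<longrightarrow> (a, x) \<notin> E)}"

definition covers :: "'c set \<Rightarrow> 'a set \<Rightarrow> bool" where
  "covers S W \<longleftrightarrow> S \<subseteq> c ` V \<and> (\<forall>w\<in>W. \<not> S \<subseteq> sparing V w)"

lemma apart_sym: "apart x y \<Longrightarrow> apart y x"
  unfolding apart_def by auto

lemma finite_sparing: "W \<subseteq> V \<Longrightarrow> finite (sparing W x)"
  unfolding sparing_def using finite_subset[OF _ finite_V] by simp

lemma sparing_no_arc: "i \<in> sparing W x \<Longrightarrow> a \<in> W \<Longrightarrow> c a = i \<Longrightarrow> (a, x) \<notin> E"
  unfolding sparing_def by blast

lemma sparing_not_own: "i \<in> sparing W x \<Longrightarrow> i \<noteq> c x"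
  unfolding sparing_def by blast

lemma not_sparing_cases:
  assumes "i \<in> c ` W" "i \<notin> sparing W x" "i \<noteq> c x"
  obtains a where "a \<in> W" "c a = i" "(a, x) \<in> E"
  using assms unfolding sparing_def by blast

lemma sparing_arc_or_apart:
  assumes "c x \<in> sparing W y" "x \<in> W"
  shows "(y, x) \<in> E \<or> apart y x"
  using sparing_no_arc[OF assms refl] sparing_not_own[OF assms(1)] unfolding apart_def by auto

text \<open>
  A vertex \<open>x\<close> spared by as many classes of \<open>W\<close> as possible lies in a dominating class: a vertex \<open>y\<close>
  of \<open>W\<close> spared by the class of \<open>x\<close> has \<open>y \<rightarrow> x\<close>, hence is spared by all classes sparing \<open>x\<close> and, in
  addition, by the class of \<open>x\<close>.
\<close>

lemma one_class_suffices:
  assumes W: "W \<subseteq> V" "W \<noteq> {}" and np: "no_apart_pair W"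
  shows "\<exists>i. covers {i} W"
proof -
  obtain w where "w \<in> W" using W by blast
  have bound: "card (sparing W y) < Suc (card (c ` W))" for y
    using card_mono[of "c ` W" "sparing W y"] finite_subset[OF W(1) finite_V]
    by (fastforce simp: sparing_def)
  obtain x where x: "x \<in> W" and max: "\<And>y. y \<in> W \<Longrightarrow> card (sparing W y) \<le> card (sparing W x)"
    using ex_has_greatest_nat[of "\<lambda>y. y \<in> W" w "\<lambda>y. card (sparing W y)" "Suc (card (c ` W))"]
      \<open>w \<in> W\<close> bound by blast
  have "c x \<notin> sparing W y" if y: "y \<in> W" for y
  proof
    assume xy: "c x \<in> sparing W y"
    have yx: "(y, x) \<in> E"
      using sparing_arc_or_apart[OF xy x] np x y unfolding no_apart_pair_def by blast
    have "sparing W x \<subseteq> sparing W y"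
    proof
      fix i assume i: "i \<in> sparing W x"
      have "i \<noteq> c y" using sparing_no_arc[OF i y] yx by blast
      moreover have "(a, y) \<notin> E" if a: "a \<in> W" "c a = i" for a
      proof -
        have "(x, a) \<in> E"
          using np x a sparing_no_arc[OF i a] sparing_not_own[OF i]
          unfolding no_apart_pair_def apart_def by blast
        then show ?thesis using no_triangle[OF yx] by blast
      qed
      ultimately show "i \<in> sparing W y" using i unfolding sparing_def by blast
    qed
    then have "sparing W x \<subset> sparing W y" using xy sparing_not_own by blast
    then show False
      using psubset_card_mono[OF finite_sparing[OF W(1)], of "sparing W x" y] max[OF y] by simp
  qed
  moreover have "sparing V y \<inter> c ` W \<subseteq> sparing W y" for y
    using W(1) unfolding sparing_def by blast
  ultimately have "covers {c x} W"
    using x W(1) unfolding covers_def by blast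
  then show ?thesis ..
qed

lemma at_most_one_class_suffices:
  assumes "W \<subseteq> V" "no_apart_pair W"
  obtains S where "covers S W" "card S \<le> 1"
proof (cases "W = {}")
  case True
  then show thesis using that[of "{}"] unfolding covers_def by simp
next
  case False
  then obtain i where "covers {i} W" using one_class_suffices assms by blast
  then show thesis using that by simp
qed

end

section \<open>No three vertices pairwise apart\<close>

locale no_apart_triple = triangle_free_multipartite V E c
  for V :: "'a set" and E :: "('a \<times> 'a) set" and c :: "'a \<Rightarrow> 'c" +
  assumes no_apart_triple:
    "x \<in> V \<Longrightarrow> y \<in> V \<Longrightarrow> z \<in> V \<Longrightarrow> apart x y \<Longrightarrow> apart y z \<Longrightarrow> \<not> apart x z"
begin

text \<open>
  An arc \<open>a \<rightarrow> y\<close> from a class that spares \<open>p\<close> and \<open>q\<close> would make \<open>a\<close>, \<open>p\<close>, \<open>q\<close> pairwise apart.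
\<close>

lemma spared_by_in_neighbour_of_pair:
  assumes V: "p \<in> V" "q \<in> V" "y \<in> V" and pq: "apart p q"
    and yp: "(y, p) \<in> E" and yq: "(y, q) \<in> E"
  shows "sparing V p \<inter> sparing V q \<subseteq> sparing V y"
proof
  fix i assume i: "i \<in> sparing V p \<inter> sparing V q"
  have "i \<noteq> c y" using i sparing_no_arc[of i V p y] V yp by blast
  moreover have "(a, y) \<notin> E" if a: "a \<in> V" "c a = i" for a
  proof
    assume ay: "(a, y) \<in> E"
    have "apart a p"
      using i a no_triangle[OF ay yp] sparing_no_arc[of i V p a] sparing_not_own[of i V p]
      unfolding apart_def by blast
    moreover have "apart a q"
      using i a no_triangle[OF ay yq] sparing_no_arc[of i V q a] sparing_not_own[of i V q]
      unfolding apart_def by blast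
    ultimately show False using no_apart_triple[OF a(1) V(1,2)] pq by blast
  qed
  ultimately show "i \<in> sparing V y" using i unfolding sparing_def by blast
qed

text \<open>
  Some class sparing \<open>p\<close> and \<open>q\<close> contains a vertex \<open>s \<rightarrow> u\<close>. Since \<open>u \<rightarrow> q\<close>, the vertex \<open>s\<close> is apart
  from \<open>q\<close>, hence \<open>p \<rightarrow> s\<close>. As \<open>u'\<close> is apart from \<open>q\<close> as well, it is adjacent to \<open>s\<close>; the arc
  \<open>s \<rightarrow> u'\<close> would close the triangle \<open>u' \<rightarrow> p \<rightarrow> s \<rightarrow> u'\<close>, so \<open>u' \<rightarrow> s\<close>, and \<open>u \<rightarrow> u'\<close> would close the
  triangle \<open>u \<rightarrow> u' \<rightarrow> s \<rightarrow> u\<close>.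
\<close>

lemma no_arc_between_sides:
  assumes V: "p \<in> V" "q \<in> V" "u \<in> V" "u' \<in> V" and pq: "apart p q"
    and u: "apart u p" "c q \<in> sparing V u" "\<not> sparing V p \<inter> sparing V q \<subseteq> sparing V u"
    and u': "apart u' q" "c p \<in> sparing V u'"
  shows "(u, u') \<notin> E"
proof
  assume uu': "(u, u') \<in> E"
  have uq: "(u, q) \<in> E"
    using sparing_arc_or_apart[OF u(2) V(2)] no_apart_triple[OF V(3,1,2) u(1) pq] by blast
  have u'p: "(u', p) \<in> E"
    using sparing_arc_or_apart[OF u'(2) V(1)]
      no_apart_triple[OF V(4,2,1) u'(1) apart_sym[OF pq]] by blast
  obtain i where i: "i \<in> sparing V p" "i \<in> sparing V q" "i \<notin> sparing V u" using u(3) by blast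
  have "i \<noteq> c u" using sparing_no_arc[OF i(2) V(3)] uq by blast
  moreover have "i \<in> c ` V" using i(1) unfolding sparing_def by blast
  ultimately obtain s where s: "s \<in> V" "c s = i" "(s, u) \<in> E"
    using not_sparing_cases i(3) by blast
  have sq: "apart s q"
    using sparing_no_arc[OF i(2) s(1,2)] sparing_not_own[OF i(2)] s(2) no_triangle[OF s(3) uq]
    unfolding apart_def by blast
  have ps: "(p, s) \<in> E"
    using no_apart_triple[OF s(1) V(2,1) sq apart_sym[OF pq]]
      sparing_no_arc[OF i(1) s(1,2)] sparing_not_own[OF i(1)] s(2)
    unfolding apart_def by blast
  have "\<not> apart u' s" using no_apart_triple[OF V(4,2) s(1) u'(1) apart_sym[OF sq]] .
  moreover have "c u' \<noteq> c s" using sparing_no_arc[OF i(1) V(4)] s(2) u'p by blast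
  moreover have "(s, u') \<notin> E" using no_triangle[OF u'p ps] .
  ultimately have "(u', s) \<in> E" unfolding apart_def by blast
  then show False using no_triangle[OF uu'] s(3) by blast
qed

lemma vertices_apart_from: "u \<in> V \<Longrightarrow> no_apart_pair {y \<in> V. apart y u}"
  unfolding no_apart_pair_def using no_apart_triple apart_sym by blast

text \<open>
  Two of the four classes are those of \<open>u\<close> and \<open>u'\<close>; the others dominate the vertices apart from \<open>u\<close>
  and those apart from \<open>u'\<close>. Hence a vertex spared by all four is apart from neither \<open>u\<close> nor \<open>u'\<close>,
  and so sends arcs to both.
\<close>

lemma four_classes_around_pair:
  assumes u: "u \<in> V" "u' \<in> V"
    and none: "\<And>y. y \<in> V \<Longrightarrow> (y, u) \<in> E \<Longrightarrow> (y, u') \<in> E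
       \<Longrightarrow> c u \<in> sparing V y \<Longrightarrow> c u' \<in> sparing V y \<Longrightarrow> False"
  shows "\<exists>S. covers S V \<and> card S \<le> 4"
proof -
  obtain S where S: "covers S {y \<in> V. apart y u}" "card S \<le> 1"
    using at_most_one_class_suffices[OF _ vertices_apart_from[OF u(1)]] by blast
  obtain S' where S': "covers S' {y \<in> V. apart y u'}" "card S' \<le> 1"
    using at_most_one_class_suffices[OF _ vertices_apart_from[OF u(2)]] by blast
  have "\<not> {c u, c u'} \<union> S \<union> S' \<subseteq> sparing V y" if y: "y \<in> V" for y
  proof
    assume spared: "{c u, c u'} \<union> S \<union> S' \<subseteq> sparing V y"
    then have "\<not> apart y u" "\<not> apart y u'" using S(1) S'(1) y unfolding covers_def by blast+
    then have "(y, u) \<in> E" "(y, u') \<in> E"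
      using spared sparing_arc_or_apart u by blast+
    then show False using none[OF y] spared by blast
  qed
  then have "covers ({c u, c u'} \<union> S \<union> S') V"
    using S(1) S'(1) u unfolding covers_def by blast
  moreover have "card ({c u, c u'} \<union> S \<union> S') \<le> 4"
    using card_Un_le[of "{c u, c u'} \<union> S" S'] card_Un_le[of "{c u, c u'}" S] S(2) S'(2)
      card_insert_le_m1[of 2 "{c u'}" "c u"] by simp
  ultimately show ?thesis by blast
qed

lemma apart_pair_with_most_sparing_classes:
  assumes "\<not> no_apart_pair V"
  obtains p q where "p \<in> V" "q \<in> V" "apart p q"
    "\<forall>r\<in>V. \<forall>s\<in>V. apart r s
       \<longrightarrow> card (sparing V r \<inter> sparing V s) \<le> card (sparing V p \<inter> sparing V q)"
proof -
  define P where "P = {(p, q). p \<in> V \<and> q \<in> V \<and> apart p q}"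
  define f where "f = (\<lambda>(p, q). card (sparing V p \<inter> sparing V q))"
  have bound: "f z < Suc (card (c ` V))" for z
    using card_mono[of "c ` V" "sparing V (fst z) \<inter> sparing V (snd z)"] finite_V
    by (fastforce simp: f_def sparing_def split: prod.split)
  obtain z\<^sub>0 where "z\<^sub>0 \<in> P" using assms unfolding P_def no_apart_pair_def by blast
  then obtain z where z: "z \<in> P" "\<And>y. y \<in> P \<Longrightarrow> f y \<le> f z"
    using ex_has_greatest_nat[of "\<lambda>y. y \<in> P" z\<^sub>0 f "Suc (card (c ` V))"] bound by blast
  obtain p q where pq: "z = (p, q)" by (cases z)
  show thesis
  proof (rule that)
    show "p \<in> V" "q \<in> V" "apart p q" using z(1) pq unfolding P_def by auto
    show "\<forall>r\<in>V. \<forall>s\<in>V. apart r s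
       \<longrightarrow> card (sparing V r \<inter> sparing V s) \<le> card (sparing V p \<inter> sparing V q)"
    proof (intro ballI impI)
      fix r s assume "r \<in> V" "s \<in> V" "apart r s"
      then show "card (sparing V r \<inter> sparing V s) \<le> card (sparing V p \<inter> sparing V q)"
        using z(2)[of "(r, s)"] pq unfolding P_def f_def by simp
    qed
  qed
qed

theorem four_classes_suffice:
  assumes "\<not> no_apart_pair V"
  shows "\<exists>S. covers S V \<and> card S \<le> 4"
proof -
  obtain p q where V: "p \<in> V" "q \<in> V" and pq: "apart p q"
    and max: "\<forall>r\<in>V. \<forall>s\<in>V. apart r s
       \<longrightarrow> card (sparing V r \<inter> sparing V s) \<le> card (sparing V p \<inter> sparing V q)"
    using apart_pair_with_most_sparing_classes[OF assms] by blast
  define C where "C = sparing V p \<inter> sparing V q"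
  define X where "X = {x \<in> V. C \<union> {c p, c q} \<subseteq> sparing V x}"
  have "no_apart_pair X"
    unfolding no_apart_pair_def
  proof (intro ballI notI)
    fix r s assume rs: "r \<in> X" "s \<in> X" "apart r s"
    \<comment> \<open>The class of \<open>p\<close> spares \<open>r\<close> and \<open>s\<close> but not \<open>p\<close>, which contradicts the maximality of \<open>C\<close>.\<close>
    have "C \<subset> sparing V r \<inter> sparing V s"
      using rs sparing_not_own[of "c p" V p] unfolding X_def C_def by blast
    then have "card C < card (sparing V r \<inter> sparing V s)"
      by (intro psubset_card_mono finite_Int disjI1 finite_sparing) auto
    then show False using max rs unfolding X_def C_def by fastforce
  qed
  then obtain K where K: "covers K X" "card K \<le> 1"
    using at_most_one_class_suffices[of X] unfolding X_def by blast
  define R where "R = {w \<in> V. {c p, c q} \<union> K \<subseteq> sparing V w}"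
  have R_not_C: "\<not> C \<subseteq> sparing V w" if "w \<in> R" for w
    using that K(1) unfolding R_def X_def covers_def by blast
  have R_sides: "apart w p \<or> apart w q" if w: "w \<in> R" for w
  proof (rule ccontr)
    assume "\<not> (apart w p \<or> apart w q)"
    then have "(w, p) \<in> E" "(w, q) \<in> E"
      using w sparing_arc_or_apart V unfolding R_def by blast+
    then have "C \<subseteq> sparing V w"
      using spared_by_in_neighbour_of_pair[OF V _ pq] w unfolding C_def R_def by blast
    then show False using R_not_C[OF w] by blast
  qed
  have no_arc: "(u, u') \<notin> E \<and> (u', u) \<notin> E"
    if u: "u \<in> R" "apart u p" and u': "u' \<in> R" "apart u' q" for u u'
    using no_arc_between_sides[OF V _ _ pq u(2) _ _ u'(2)]
      no_arc_between_sides[OF V(2,1) _ _ apart_sym[OF pq] u'(2) _ _ u(2)]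
      R_not_C[OF u(1)] R_not_C[OF u'(1)] u(1) u'(1)
    unfolding R_def C_def by (simp add: Int_commute)
  show ?thesis
  proof (cases "no_apart_pair R")
    case True
    then obtain L where L: "covers L R" "card L \<le> 1"
      using at_most_one_class_suffices[of R] unfolding R_def by blast
    have "covers ({c p, c q} \<union> K \<union> L) V"
      using K(1) L(1) V unfolding covers_def R_def by blast
    moreover have "card ({c p, c q} \<union> K \<union> L) \<le> 4"
      using card_Un_le[of "{c p, c q} \<union> K" L] card_Un_le[of "{c p, c q}" K] K(2) L(2)
        card_insert_le_m1[of 2 "{c q}" "c p"] by simp
    ultimately show ?thesis by blast
  next
    case False
    then obtain v v' where v: "v \<in> R" "v' \<in> R" "apart v v'" unfolding no_apart_pair_def by blast
    have vV: "v \<in> V" "v' \<in> V" using v unfolding R_def by auto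
    have "\<not> (apart v z \<and> apart v' z)" if "z \<in> V" for z
      using vertices_apart_from[OF that] vV v(3) unfolding no_apart_pair_def by blast
    then have "apart v p \<and> apart v' q \<or> apart v' p \<and> apart v q"
      using R_sides[OF v(1)] R_sides[OF v(2)] V by blast
    then obtain u u' where u: "u \<in> R" "apart u p" and u': "u' \<in> R" "apart u' q"
      and uu': "apart u u'"
      using v apart_sym[OF v(3)] by blast
    have uV: "u \<in> V" "u' \<in> V" using u u' unfolding R_def by auto
    show ?thesis
    proof (rule four_classes_around_pair[OF uV])
      fix y assume y: "y \<in> V" "(y, u) \<in> E" "(y, u') \<in> E"
      have "y \<in> R"
        using spared_by_in_neighbour_of_pair[OF uV y(1) uu' y(2,3)] u(1) u'(1) y(1)
        unfolding R_def by blast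
      then show False using R_sides[of y] no_arc u u' y(2,3) by blast
    qed
  qed
qed

end

section \<open>Partite classes, independence and domination numbers\<close>

context multipartite_digraph
begin

definition class_of :: "'a \<Rightarrow> nat" where
  "class_of v = (THE i. i \<in> {1..t} \<and> v \<in> A i)"

lemma class_of_eq: "i \<in> {1..t} \<Longrightarrow> v \<in> A i \<Longrightarrow> class_of v = i"
  unfolding class_of_def using classes_disjoint unfolding disjoint_family_on_def
  by (intro the_equality conjI) blast+

lemma class_of_mem:
  assumes "v \<in> pverts D"
  shows "class_of v \<in> {1..t}" "v \<in> A (class_of v)"
proof -
  obtain i where "i \<in> {1..t}" "v \<in> A i" using assms classes_cover by blast
  then show "class_of v \<in> {1..t}" "v \<in> A (class_of v)" using class_of_eq by auto
qed

lemma class_subset: "i \<in> {1..t} \<Longrightarrow> A i \<subseteq> pverts D"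
  using classes_cover by blast

lemma triangle_free_multipartiteI:
  assumes "\<not> has_cyclic_triangle D"
  shows "triangle_free_multipartite (pverts D) (parcs D) class_of"
proof
  show "finite (pverts D)" by simp
next
  fix x y assume xy: "(x, y) \<in> parcs D"
  then have V: "x \<in> pverts D" "y \<in> pverts D" and ne: "x \<noteq> y"
    using wellformed[of "(x, y)"] no_loops[of "(x, y)"] by auto
  show "class_of x \<noteq> class_of y"
  proof
    assume "class_of x = class_of y"
    then show False
      using classes_independent[OF class_of_mem(1)[OF V(1)]] class_of_mem(2)[OF V(1)]
        class_of_mem(2)[OF V(2)] ne xy
      unfolding independent_set_def adjacent_def by auto
  qed
next
  fix x y z assume "(x, y) \<in> parcs D" "(y, z) \<in> parcs D"
  then show "(z, x) \<notin> parcs D" using assms unfolding has_cyclic_triangle_def by blast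
qed

abbreviation transversal :: "'a set \<Rightarrow> bool" where
  "transversal I \<equiv> independent_set D I \<and> from_different_classes A t I"

lemma transversal_if_pairwise:
  assumes "I \<subseteq> pverts D"
    and "\<And>x y. x \<in> I \<Longrightarrow> y \<in> I \<Longrightarrow> x \<noteq> y \<Longrightarrow> class_of x \<noteq> class_of y \<and> \<not> adjacent D x y"
  shows "transversal I"
  using assms class_of_eq unfolding independent_set_def from_different_classes_def by metis

lemma transversal_pairwise:
  assumes "transversal I" "x \<in> I" "y \<in> I" "x \<noteq> y"
  shows "class_of x \<noteq> class_of y" "\<not> adjacent D x y" "x \<in> pverts D" "y \<in> pverts D"
proof -
  show V: "x \<in> pverts D" "y \<in> pverts D" and "\<not> adjacent D x y"
    using assms unfolding independent_set_def by auto
  show "class_of x \<noteq> class_of y"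
    using assms class_of_mem[OF V(1)] class_of_mem[OF V(2)]
    unfolding from_different_classes_def by metis
qed

lemma finite_transversal_sizes: "finite {card I | I. transversal I}"
proof (rule finite_subset)
  show "{card I | I. transversal I} \<subseteq> card ` Pow (pverts D)"
    unfolding independent_set_def by auto
qed simp

lemma card_transversal_le:
  assumes "transversal I"
  shows "card I \<le> multipartite_independence_number D A t"
  unfolding multipartite_independence_number_def
  using Max_ge[OF finite_transversal_sizes] assms by blast

lemma largest_transversal:
  obtains I where "transversal I" "card I = multipartite_independence_number D A t"
proof -
  have "transversal {}" unfolding independent_set_def from_different_classes_def by simp
  then have "{card I | I. transversal I} \<noteq> {}" by blast
  then have "multipartite_independence_number D A t \<in> {card I | I. transversal I}"
    unfolding multipartite_independence_number_def
    using Max_in[OF finite_transversal_sizes] by blast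
  then show thesis using that by auto
qed

lemma domination_number_le:
  assumes "dominating D A t S"
  shows "domination_number D A t \<le> card S"
  unfolding domination_number_def using assms by (intro Least_le) blast

lemma domination_number_pos:
  assumes "pverts D \<noteq> {}"
  shows "domination_number D A t \<noteq> 0"
proof
  assume zero: "domination_number D A t = 0"
  have "dominating D A t {1..t}" unfolding dominating_def by simp
  then have "\<exists>S. dominating D A t S \<and> card S = card {1..t}" by blast
  then have "\<exists>S. dominating D A t S \<and> card S = domination_number D A t"
    unfolding domination_number_def by (rule LeastI)
  then obtain S where S: "dominating D A t S" "card S = 0" using zero by auto
  then have "S = {}" unfolding dominating_def using finite_subset[of S "{1..t}"] by auto
  then have "(\<Union>i\<in>{1..t}. A i) = {}" using S(1) unfolding dominating_def by auto
  then show False using assms classes_cover by simp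
qed

lemma dominating_if_covers:
  assumes "\<not> has_cyclic_triangle D"
    and S: "triangle_free_multipartite.covers (pverts D) (parcs D) class_of S (pverts D)"
  shows "dominating D A t S"
proof -
  interpret triangle_free_multipartite "pverts D" "parcs D" class_of
    by (rule triangle_free_multipartiteI[OF assms(1)])
  have sub: "S \<subseteq> class_of ` pverts D" using S unfolding covers_def by blast
  then have St: "S \<subseteq> {1..t}" using class_of_mem(1) by blast
  have "\<exists>w \<in> (\<Union>i\<in>S. A i). (w, v) \<in> parcs D" if i: "i \<in> {1..t} - S" "v \<in> A i" for i v
  proof -
    have v: "v \<in> pverts D" "class_of v \<notin> S" using i class_subset class_of_eq by auto
    then obtain j where j: "j \<in> S" "j \<notin> sparing (pverts D) v" using S unfolding covers_def by blast
    have "j \<in> class_of ` pverts D" "j \<noteq> class_of v" using j(1) sub v(2) by blast+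
    then obtain a where "a \<in> pverts D" "class_of a = j" "(a, v) \<in> parcs D"
      using j(2) unfolding sparing_def by blast
    then show ?thesis using j(1) class_of_mem(2) by blast
  qed
  then show ?thesis using St unfolding dominating_def by blast
qed

lemma domination_number_if_independence_one:
  assumes tri: "\<not> has_cyclic_triangle D"
    and one: "multipartite_independence_number D A t = 1"
  shows "domination_number D A t = 1"
proof -
  interpret triangle_free_multipartite "pverts D" "parcs D" class_of
    by (rule triangle_free_multipartiteI[OF tri])
  obtain I where "transversal I" "card I = 1" using largest_transversal one by metis
  then have ne: "pverts D \<noteq> {}" unfolding independent_set_def by auto
  have "no_apart_pair (pverts D)"
    unfolding no_apart_pair_def
  proof (intro ballI notI)
    fix x y assume xy: "x \<in> pverts D" "y \<in> pverts D" "apart x y"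
    then have "transversal {x, y}"
      by (intro transversal_if_pairwise) (auto simp: apart_def adjacent_def)
    moreover have "x \<noteq> y" using xy(3) by (auto simp: apart_def)
    ultimately show False using card_transversal_le[of "{x, y}"] one by simp
  qed
  then obtain i where "covers {i} (pverts D)" using one_class_suffices ne by blast
  then have "domination_number D A t \<le> 1"
    using domination_number_le[OF dominating_if_covers[OF tri]] by fastforce
  then show ?thesis using domination_number_pos[OF ne] by simp
qed

lemma domination_number_if_independence_two:
  assumes tri: "\<not> has_cyclic_triangle D"
    and two: "multipartite_independence_number D A t = 2"
  shows "domination_number D A t \<le> 4"
proof -
  interpret triangle_free_multipartite "pverts D" "parcs D" class_of
    by (rule triangle_free_multipartiteI[OF tri])
  interpret no_apart_triple "pverts D" "parcs D" class_of
  proof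
    fix x y z assume V: "x \<in> pverts D" "y \<in> pverts D" "z \<in> pverts D"
      and xy: "apart x y" and yz: "apart y z"
    show "\<not> apart x z"
    proof
      assume xz: "apart x z"
      have "class_of a \<noteq> class_of b \<and> \<not> adjacent D a b"
        if "a \<in> {x, y, z}" "b \<in> {x, y, z}" "a \<noteq> b" for a b
      proof -
        have "apart a b" using that xy yz xz apart_sym by blast
        then show ?thesis unfolding apart_def adjacent_def by blast
      qed
      then have "transversal {x, y, z}" using V by (intro transversal_if_pairwise) blast+
      then have "card {x, y, z} \<le> 2" using card_transversal_le two by metis
      moreover have "x \<noteq> y" "y \<noteq> z" "x \<noteq> z" using xy yz xz unfolding apart_def by blast+
      then have "card {x, y, z} = 3" by simp
      ultimately show False by linarith
    qed
  qed
  obtain I where I: "transversal I" "card I = 2" using largest_transversal two by metis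
  then obtain x y where xy: "I = {x, y}" "x \<noteq> y" by (meson card_2_iff)
  then have "apart x y" "x \<in> pverts D" "y \<in> pverts D"
    using transversal_pairwise[OF I(1), of x y] unfolding apart_def adjacent_def by auto
  then have "\<not> no_apart_pair (pverts D)" unfolding no_apart_pair_def by blast
  then obtain S where "covers S (pverts D)" "card S \<le> 4" using four_classes_suffice by blast
  then show ?thesis using domination_number_le[OF dominating_if_covers[OF tri]] by fastforce
qed

end

theorem theorem2:
  fixes D :: "'a pair_pre_digraph" and A :: "nat \<Rightarrow> 'a set" and t :: nat
  assumes "multipartite_digraph D A t"
    and "\<not> has_cyclic_triangle D"
  shows "(multipartite_independence_number D A t = 1 \<longrightarrow> domination_number D A t = 1) \<and>
         (multipartite_independence_number D A t = 2 \<longrightarrow> domination_number D A t \<le> 4)"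
proof -
  interpret multipartite_digraph D A t by (rule assms(1))
  show ?thesis
    using domination_number_if_independence_one domination_number_if_independence_two assms(2)
    by blast
qed

end
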